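(* Let $f_1,f_2:\mathbb R^+\to\mathbb R^+$ be continuous and strictly increasing with $f_i(x)>0$ for $x>0$, $i=1,2$. Assume that the equation $f_1^{-1}(x)=f_2(x)$ has exactly one positive solution $K>0$, where $f_2(x)>f_1^{-1}(x)$ for $f_1(0)<x<K$ and $f_2(x)<f_1^{-1}(x)$ for $x>K$. Let $h_i:\mathbb R^+\to\mathbb R$ ($i=1,2$) be Lebesgue measurable with $h_i(t)\le t$ and $\lim_{t\to\infty}h_i(t)=\infty$. For $i=1,2$ let $R_i(t,\cdot)$ be left continuous and non-decreasing for any $t$, let $R_i(\cdot,s)$ be locally integrable for any $s$, let $R_i(t,s)=0$ for $s\le h_i(t)$ and $R_i(t,t^+)=1$, and let $r_i$ be a Lebesgue measurable essentially bounded function on $\mathbb R^+$ with $r_i(t)\ge 0$. Let $\varphi,\psi:(-\infty,0]\to\mathbb R$ be continuous bounded functions with $\varphi(t)\ge 0$, $\psi(t)\ge 0$ for $t<0$ and $\varphi(0)>0$, $\psi(0)>0$. Consider the initial value problem (P) described in the context. Any solution of (P) with initial functions satisfying $\varphi(t)\ge K$, $\psi(t)\ge f_2(K)$ for all $t\le0$ satisfies $x(t)\ge K$, $y(t)\ge f_2(K)$ for any $t\ge0$, while any solution of (P) with $\varphi(t)\le K$, $\psi(t)\le f_2(K)$ for all $t\le 0$ satisfies $x(t)\le K$, $y(t)\le f_2(K)$ for any $t\ge 0$.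
   Context: $\mathbb R^+=[0,\infty)$; $u(t^+)$ is the right-side limit of $u$ at $t$. Problem (P) is the system $$x'(t)=r_1(t)\left[\int_{h_1(t)}^t f_1(y(s))\,d_sR_1(t,s)-x(t)\right],\quad y'(t)=r_2(t)\left[\int_{h_2(t)}^t f_2(x(s))\,d_sR_2(t,s)-y(t)\right]$$ with the initial conditions $x(t)=\varphi(t)$, $y(t)=\psi(t)$ for $t\le 0$. The integrals are Stieltjes integrals in $s$ over $[h_i(t),t]$ including the endpoint atoms, i.e. with respect to the probability measure on $[h_i(t),t]$ with (left continuous) distribution function $R_i(t,\cdot)$. A solution is a pair $(x,y)$, locally absolutely continuous on $[0,\infty)$, which satisfies the system for almost all $t\ge0$ and the initial conditions for $t\le0$. Convention: $f_1^{-1}$ is the inverse of $f_1$ on its range, $f_1^{-1}(x)=0$ for $0\le x<f_1(0)$, and $f_1^{-1}(x)=+\infty$ for $x$ above the range of $f_1$. *)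

theory Defs
  imports "HOL-Analysis.Analysis"
begin

definition absolutely_continuous_on :: "real set \<Rightarrow> (real \<Rightarrow> real) \<Rightarrow> bool" where
  "absolutely_continuous_on S f \<longleftrightarrow>
     (\<forall>\<epsilon>>0. \<exists>\<delta>>0. \<forall>I :: (real \<times> real) set.
        finite I \<and> (\<forall>(a, b)\<in>I. a \<le> b \<and> {a..b} \<subseteq> S) \<and>
        pairwise (\<lambda>p q. {fst p<..<snd p} \<inter> {fst q<..<snd q} = {}) I \<and>
        (\<Sum>(a, b)\<in>I. b - a) < \<delta>
        \<longrightarrow> (\<Sum>(a, b)\<in>I. \<bar>f b - f a\<bar>) < \<epsilon>)"

definition locally_integrable_nonneg :: "(real \<Rightarrow> real) \<Rightarrow> bool" where
  "locally_integrable_nonneg g \<longleftrightarrow> (\<forall>b\<ge>0. set_integrable lebesgue {0..b} g)"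

text \<open>
  Here \<open>f\<close> is continuous and strictly increasing on \<open>[0, \<infinity>)\<close>, so its range on that set is an interval
  with least element \<open>f 0\<close>, and the last branch consists exactly of the points above the range.
\<close>
definition extended_inverse :: "(real \<Rightarrow> real) \<Rightarrow> real \<Rightarrow> ereal" where
  "extended_inverse f x =
     (if x < f 0 then 0
      else if x \<in> f ` {0..} then ereal (the_inv_into {0..} f x)
      else \<infinity>)"

text \<open>
  The Stieltjes measure of a left-continuous non-decreasing \<open>G\<close>, for which \<open>[a, b)\<close> has mass
  \<open>G b - G a\<close>. The library's \<^const>\<open>interval_measure\<close> expects a right-continuous
  function, so \<open>G\<close> is replaced by its right-limit regularization \<open>s \<mapsto> G (s+)\<close>, which determines the same
  measure. The mass of a closed interval is \<open>G (b+) - G a\<close>, i.e. both endpoint atoms are counted.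
\<close>
definition left_stieltjes_measure :: "(real \<Rightarrow> real) \<Rightarrow> real measure" where
  "left_stieltjes_measure G = interval_measure (\<lambda>s. Lim (at_right s) G)"

lemma emeasure_left_stieltjes_measure_Icc:
  fixes G :: "real \<Rightarrow> real"
  assumes G: "mono G" and lc: "\<And>s. continuous (at_left s) G"
    and L: "(G \<longlongrightarrow> L) (at_right b)" and ab: "a \<le> b"
  shows "emeasure (left_stieltjes_measure G) {a..b} = ennreal (L - G a)"
proof -
  define F where "F s = Lim (at_right s) G" for s
  have F_lim: "(G \<longlongrightarrow> F s) (at_right s)" for s
  proof -
    have "(G \<longlongrightarrow> Inf (G ` ({s<..} \<inter> UNIV))) (at s within ({s<..} \<inter> UNIV))"
      using G by (intro Lim_right_bound[where K = "G s"]) (auto simp: mono_def)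
    then have *: "(G \<longlongrightarrow> Inf (G ` {s<..})) (at_right s)" by simp
    then have "F s = Inf (G ` {s<..})"
      unfolding F_def by (intro tendsto_Lim) auto
    with * show ?thesis by simp
  qed
  have F_ge: "G s \<le> F s" for s
    by (rule tendsto_lowerbound[OF F_lim])
      (use G in \<open>auto simp: eventually_at_filter mono_def\<close>)
  have F_le: "F s \<le> G u" if "s < u" for s u
    by (rule tendsto_upperbound[OF F_lim])
      (use G that in \<open>auto simp: eventually_at_right[OF that] mono_def intro!: exI[of _ u]\<close>)
  have F_mono: "F s \<le> F u" if "s \<le> u" for s u
    using F_ge[of u] F_le[of s u] that by (cases "s = u") auto
  have F_rc: "continuous (at_right s) F" for s
    unfolding continuous_within
  proof (rule tendstoI)
    fix e :: real assume "e > 0"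
    then have "eventually (\<lambda>u. dist (G u) (F s) < e) (at_right s)"
      using F_lim tendstoD by blast
    then obtain c where c: "c > s" "\<And>u. s < u \<Longrightarrow> u < c \<Longrightarrow> dist (G u) (F s) < e"
      by (metis eventually_at_right_field)
    have "dist (F u) (F s) < e" if u: "s < u" "u < c" for u
    proof -
      obtain v where v: "u < v" "v < c" using u dense by blast
      have "F s \<le> F u" "F u \<le> G v" using F_mono F_le u v by auto
      moreover have "dist (G v) (F s) < e" using c(2) u v by auto
      ultimately show ?thesis by (auto simp: dist_real_def)
    qed
    then show "eventually (\<lambda>u. dist (F u) (F s) < e) (at_right s)"
      using c(1) by (auto simp: eventually_at_right_field)
  qed
  let ?M = "interval_measure F"
  let ?A = "\<lambda>n::nat. {a - 1 / Suc n<..b}"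
  have Ioc: "emeasure ?M {c<..d} = F d - F c" if "c \<le> d" for c d
    by (rule emeasure_interval_measure_Ioc[OF that F_mono F_rc])
  have left: "(\<lambda>n::nat. F (a - 1 / Suc n)) \<longlonglongrightarrow> G a"
  proof (rule tendsto_sandwich)
    show "(\<lambda>n::nat. G (a - 1 / Suc n)) \<longlonglongrightarrow> G a"
    proof -
      have "(G \<longlongrightarrow> G a) (at_left a)" using lc[of a] by (simp add: continuous_within)
      moreover have "filterlim (\<lambda>n::nat. a - 1 / Suc n) (at_left a) sequentially"
        unfolding filterlim_at
      proof
        show "(\<lambda>n::nat. a - 1 / Suc n) \<longlonglongrightarrow> a"
          using tendsto_diff[OF tendsto_const LIMSEQ_inverse_real_of_nat]
          by (simp add: inverse_eq_divide)
      qed auto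
      ultimately show ?thesis by (rule filterlim_compose)
    qed
    show "eventually (\<lambda>n::nat. G (a - 1 / Suc n) \<le> F (a - 1 / Suc n)) sequentially"
      using F_ge by simp
    show "eventually (\<lambda>n::nat. F (a - 1 / Suc n) \<le> G a) sequentially"
      using F_le by simp
  qed simp
  have "{a..b} = (\<Inter>n. ?A n)"
  proof (intro equalityI subsetI)
    fix z assume z: "z \<in> (\<Inter>n. ?A n)"
    have "a \<le> z"
    proof (rule ccontr)
      assume "\<not> a \<le> z"
      then obtain n where "inverse (real (Suc n)) < a - z"
        using reals_Archimedean[of "a - z"] by auto
      with z show False by (auto simp: inverse_eq_divide dest: spec[of _ n])
    qed
    with z show "z \<in> {a..b}" by auto
  qed (auto intro: less_le_trans[of _ a])
  moreover have "(\<lambda>n. emeasure ?M (?A n)) \<longlonglongrightarrow> emeasure ?M (\<Inter>n. ?A n)"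
  proof (rule Lim_emeasure_decseq)
    show "decseq ?A"
    proof (rule decseq_SucI, rule subsetI)
      fix n z assume z: "z \<in> ?A (Suc n)"
      have "1 / real (Suc (Suc n)) \<le> 1 / real (Suc n)" by (intro frac_le) auto
      moreover have "a - 1 / real (Suc (Suc n)) < z" "z \<le> b"
        using z by (simp_all only: greaterThanAtMost_iff)
      ultimately have "a - 1 / real (Suc n) < z" "z \<le> b" by linarith+
      then show "z \<in> ?A n" by (simp only: greaterThanAtMost_iff)
    qed
    show "emeasure ?M (?A n) \<noteq> \<infinity>" for n
      using ab by (subst Ioc) (auto intro: order_trans[of _ a])
  qed auto
  moreover have "(\<lambda>n. emeasure ?M (?A n)) = (\<lambda>n. ennreal (F b - F (a - 1 / Suc n)))"
    using ab by (intro ext Ioc) (auto intro: order_trans[of _ a])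
  moreover have "(\<lambda>n. ennreal (F b - F (a - 1 / Suc n))) \<longlonglongrightarrow> ennreal (F b - G a)"
    by (intro tendsto_intros left)
  ultimately have "emeasure ?M {a..b} = ennreal (F b - G a)"
    using LIMSEQ_unique by metis
  moreover have "F b = L"
    using F_lim L by (rule tendsto_unique[rotated]) auto
  moreover have "left_stieltjes_measure G = interval_measure F"
    by (simp add: left_stieltjes_measure_def F_def[abs_def])
  ultimately show ?thesis by simp
qed

text \<open>
  \<open>x, y\<close> are total functions, prescribed by the initial functions on \<open>(-\<infinity>, 0]\<close>.
  Only the values of \<open>f\<^sub>i\<close>, \<open>h\<^sub>i\<close>, \<open>R\<^sub>i\<close>, \<open>r\<^sub>i\<close> for arguments (first argument for \<open>R\<^sub>i\<close>) in
  \<open>[0, \<infinity>)\<close> are meaningful. No sign condition is imposed on \<open>x, y\<close>.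
\<close>
definition is_solution ::
  "(real \<Rightarrow> real) \<Rightarrow> (real \<Rightarrow> real) \<Rightarrow> (real \<Rightarrow> real) \<Rightarrow> (real \<Rightarrow> real) \<Rightarrow>
   (real \<Rightarrow> real \<Rightarrow> real) \<Rightarrow> (real \<Rightarrow> real \<Rightarrow> real) \<Rightarrow> (real \<Rightarrow> real) \<Rightarrow> (real \<Rightarrow> real) \<Rightarrow>
   (real \<Rightarrow> real) \<Rightarrow> (real \<Rightarrow> real) \<Rightarrow> (real \<Rightarrow> real) \<Rightarrow> (real \<Rightarrow> real) \<Rightarrow> bool" where
  "is_solution f1 f2 h1 h2 R1 R2 r1 r2 \<phi> \<psi> x y \<longleftrightarrow>
     (\<forall>b\<ge>0. absolutely_continuous_on {0..b} x \<and> absolutely_continuous_on {0..b} y) \<and>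
     (AE t in lebesgue. 0 \<le> t \<longrightarrow>
        (x has_real_derivative
           r1 t * ((LINT s:{h1 t..t}|left_stieltjes_measure (R1 t). f1 (y s)) - x t)) (at t)) \<and>
     (AE t in lebesgue. 0 \<le> t \<longrightarrow>
        (y has_real_derivative
           r2 t * ((LINT s:{h2 t..t}|left_stieltjes_measure (R2 t). f2 (x s)) - y t)) (at t)) \<and>
     (\<forall>t\<le>0. x t = \<phi> t \<and> y t = \<psi> t)"

end

theory Submission
  imports Defs
begin

text \<open>
  Below and above the equilibrium \<open>(K, f\<^sub>2 K)\<close> there are strictly invariant regions arbitrarily close
  to it. For \<open>k > K\<close> slightly larger than \<open>K\<close>, \<open>f\<^sub>2 k < f\<^sub>1\<^sup>-\<^sup>1 k\<close> leaves room for some \<open>l\<close> with \<open>f\<^sub>2 k < l\<close>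
  and \<open>f\<^sub>1 l < k\<close>. As long as \<open>x \<le> k\<close> and \<open>y \<le> l\<close>, the averages in the two equations are at most
  \<open>f\<^sub>1 l < k\<close> and \<open>f\<^sub>2 k < l\<close>, and since each component relaxes towards its average, neither can be the
  first to reach its bound. Letting \<open>k\<close> tend to \<open>K\<close> gives the upper estimate; the lower one is
  symmetric. Strictness makes simultaneous exit harmless and replaces any uniqueness argument, which
  would fail because \<open>f\<^sub>1, f\<^sub>2\<close> need not be Lipschitz.
\<close>

section \<open>Increments of absolutely continuous functions\<close>

text \<open>
  A tagged division fine for a suitable gauge splits the increment of \<open>f\<close> into intervals tagged outside
  the exceptional null set, where differentiability bounds the increment, and intervals tagged in it,
  which lie in an open set of small measure, so that absolute continuity makes them negligible.
\<close>
lemma absolutely_continuous_on_increment_ge: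
  fixes f :: "real \<Rightarrow> real"
  assumes ab: "a \<le> b" and ac: "absolutely_continuous_on {a..b} f"
    and deriv: "AE t in lebesgue. a < t \<and> t < b \<longrightarrow> (\<exists>D\<ge>c. (f has_real_derivative D) (at t))"
  shows "f b - f a \<ge> c * (b - a)"
proof -
  obtain N0 where N0: "\<And>t. t \<notin> N0 \<Longrightarrow> a < t \<and> t < b \<longrightarrow> (\<exists>D\<ge>c. (f has_real_derivative D) (at t))"
    and "N0 \<in> null_sets lebesgue"
    using AE_E3[OF deriv] by auto
  \<comment> \<open>The endpoints join the exceptional set because the derivative is controlled only
    on the open interval; \<open>N\<close> stays negligible.\<close>
  define N where "N = N0 \<union> {a, b}"
  have "negligible N"
    using \<open>N0 \<in> null_sets lebesgue\<close> by (simp add: N_def negligible_iff_null_sets[symmetric])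
  then have N_null: "N \<in> null_sets lebesgue" by (simp add: negligible_iff_null_sets)
  \<comment> \<open>The error consists of \<open>e * (b - a)\<close> from using the slope
    \<open>c - e\<close>, one \<open>e\<close> from the increments of \<open>f\<close> over
    intervals tagged in \<open>N\<close>, and one \<open>e\<close> from \<open>c - e\<close> times
    the total length of these intervals.\<close>
  have approx: "f b - f a \<ge> c * (b - a) - e * (b - a + 2)" if e: "e > 0" for e
  proof -
    obtain \<delta> where "\<delta> > 0" and \<delta>: "\<And>I. finite I \<Longrightarrow> (\<forall>(u, v)\<in>I. u \<le> v \<and> {u..v} \<subseteq> {a..b}) \<Longrightarrow>
        pairwise (\<lambda>p q. {fst p<..<snd p} \<inter> {fst q<..<snd q} = {}) I \<Longrightarrow>
        (\<Sum>(u, v)\<in>I. v - u) < \<delta> \<Longrightarrow> (\<Sum>(u, v)\<in>I. \<bar>f v - f u\<bar>) < e"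
      using ac e unfolding absolutely_continuous_on_def by meson
    \<comment> \<open>The bound \<open>\<delta>\<close> makes the increments over short systems
      small; the other one keeps \<open>\<bar>c\<bar> * \<eta>\<close> at most
      \<open>e\<close>.\<close>
    define \<eta> where "\<eta> = min \<delta> (e / (\<bar>c\<bar> + 1))"
    have "\<eta> > 0" using \<open>\<delta> > 0\<close> e by (simp add: \<eta>_def add_nonneg_pos)
    have \<eta>_c: "\<bar>c\<bar> * \<eta> \<le> e"
    proof -
      have "\<bar>c\<bar> * \<eta> \<le> (\<bar>c\<bar> + 1) * (e / (\<bar>c\<bar> + 1))"
        using \<open>\<eta> > 0\<close> by (intro mult_mono) (auto simp: \<eta>_def)
      also have "\<dots> = e" using abs_ge_zero[of c] by (simp del: abs_ge_zero)
      finally show ?thesis .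
    qed
    obtain U where U: "open U" "N \<subseteq> U" "emeasure lebesgue (U - N) < ennreal \<eta>"
      using sets_lebesgue_outer_open[of N \<eta>] N_null \<open>\<eta> > 0\<close> by blast
    have U_sets: "U \<in> sets lebesgue" using U(1) by simp
    have U_small: "emeasure lebesgue U < ennreal \<eta>"
      using U(3) emeasure_Diff_null_set[OF N_null U_sets] by simp
    \<comment> \<open>Straddle lemma in one-sided form: near \<open>t\<close>, difference quotients
      to either side are at least \<open>c - e\<close>.\<close>
    have straddle: "\<exists>d>0. \<forall>u. \<bar>u - t\<bar> < d \<longrightarrow>
        (u \<ge> t \<longrightarrow> f u - f t \<ge> (c - e) * (u - t)) \<and> (u \<le> t \<longrightarrow> f t - f u \<ge> (c - e) * (t - u))"
      if "t \<in> {a..b}" "t \<notin> N" for t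
    proof -
      have "a < t" "t < b" "t \<notin> N0" using that by (auto simp: N_def less_le)
      then obtain D where D: "D \<ge> c" "(f has_real_derivative D) (at t)"
        using N0 by blast
      obtain d where "d > 0" and d: "\<And>u. \<bar>u - t\<bar> < d \<Longrightarrow> \<bar>f u - f t - D * (u - t)\<bar> \<le> e * \<bar>u - t\<bar>"
        using D(2) e unfolding has_field_derivative_def has_derivative_at_alt by (auto simp: mult.commute)
      show ?thesis
      proof (intro exI[of _ d] conjI allI impI)
        fix u assume u: "\<bar>u - t\<bar> < d" "u \<ge> t"
        have "c * (u - t) \<le> D * (u - t)" using u D(1) by (intro mult_right_mono) auto
        then show "(c - e) * (u - t) \<le> f u - f t" using d[OF u(1)] u(2)
          by (simp only: left_diff_distrib[of c e] abs_of_nonneg[of "u - t"])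
      next
        fix u assume u: "\<bar>u - t\<bar> < d" "u \<le> t"
        have "c * (t - u) \<le> D * (t - u)" using u D(1) by (intro mult_right_mono) auto
        then show "(c - e) * (t - u) \<le> f t - f u" using d[OF u(1)] u(2)
            minus_mult_right[of D "t - u"]
          by (simp only: left_diff_distrib[of c e] abs_of_nonpos[of "u - t"] minus_diff_eq)
      qed (use \<open>d > 0\<close> in auto)
    qed
    then obtain d where d_pos: "\<And>t. t \<in> {a..b} \<Longrightarrow> t \<notin> N \<Longrightarrow> d t > 0"
      and d: "\<And>t u. t \<in> {a..b} \<Longrightarrow> t \<notin> N \<Longrightarrow> \<bar>u - t\<bar> < d t \<Longrightarrow>
        (u \<ge> t \<longrightarrow> f u - f t \<ge> (c - e) * (u - t)) \<and> (u \<le> t \<longrightarrow> f t - f u \<ge> (c - e) * (t - u))"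
      by metis
    \<comment> \<open>Intervals tagged in \<open>N\<close> are forced into the small open set
      \<open>U\<close>; all others in \<open>{a..b}\<close> are short enough for the straddle
      estimate.\<close>
    define \<gamma> where "\<gamma> t = (if t \<in> N then U else if t \<in> {a..b} then ball t (d t) else UNIV)" for t
    have "gauge \<gamma>" using U d_pos by (auto simp: gauge_def \<gamma>_def)
    then obtain p where p: "p tagged_division_of {a..b}" "\<gamma> fine p"
      using fine_division_exists_real by blast
    note pD = tagged_division_ofD[OF p(1)]
    have interval: "\<exists>u v. u \<le> v \<and> k = {u..v} \<and> t \<in> {u..v} \<and> {u..v} \<subseteq> {a..b} \<and> {u..v} \<subseteq> \<gamma> t" if "(t, k) \<in> p" for t k
      using pD(2-4)[OF that] p(2) that by (fastforce simp: fine_def)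
    define q where "q = {(t, k) \<in> p. t \<in> N}"
    have "q \<subseteq> p" by (auto simp: q_def)
    have "finite q" using \<open>q \<subseteq> p\<close> pD(1) finite_subset by blast
    have q_partial: "q tagged_partial_division_of {a..b}"
      using tagged_partial_division_subset[OF _ \<open>q \<subseteq> p\<close>] p(1) by (simp add: tagged_division_of_def)
    define \<D> where "\<D> = snd ` q"
    have \<D>: "\<D> division_of \<Union>\<D>"
      unfolding \<D>_def by (rule partial_division_of_tagged_division[OF q_partial])
    have \<D>_interval: "\<exists>u v. u \<le> v \<and> k = {u..v} \<and> {u..v} \<subseteq> {a..b} \<and> {u..v} \<subseteq> U" if "k \<in> \<D>" for k
    proof -
      from that obtain t where "(t, k) \<in> p" "t \<in> N" by (auto simp: \<D>_def q_def)
      then show ?thesis using interval[of t k] by (auto simp: \<gamma>_def)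
    qed
    have "finite \<D>" using \<open>finite q\<close> by (simp add: \<D>_def)
    \<comment> \<open>Absolute continuity speaks of sets of endpoint pairs, so intervals are
      recoded; injectivity on \<open>\<D>\<close> preserves the sums.\<close>
    define ends where "ends k = (Inf k, Sup k)" for k :: "real set"
    have inj: "inj_on ends \<D>"
    proof (rule inj_onI)
      fix k l assume "k \<in> \<D>" "l \<in> \<D>" "ends k = ends l"
      then show "k = l" using \<D>_interval[of k] \<D>_interval[of l] by (auto simp: ends_def)
    qed
    have \<D>_length: "(\<Sum>k\<in>\<D>. Sup k - Inf k) < \<eta>"
    proof -
      have "(\<Sum>k\<in>\<D>. Sup k - Inf k) = (\<Sum>k\<in>\<D>. measure lebesgue k)"
      proof (rule sum.cong)
        fix k assume "k \<in> \<D>"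
        then show "Sup k - Inf k = measure lebesgue k" using \<D>_interval[of k] by auto
      qed simp
      also have "\<dots> = measure lebesgue (\<Union>\<D>)" by (rule content_division[OF \<D>])
      finally have eq: "(\<Sum>k\<in>\<D>. Sup k - Inf k) = measure lebesgue (\<Union>\<D>)" .
      have "ennreal (measure lebesgue (\<Union>\<D>)) = emeasure lebesgue (\<Union>\<D>)"
        using lmeasurable_division[OF \<D>] by (simp add: emeasure_eq_measure2)
      also have "\<dots> \<le> emeasure lebesgue U"
        using \<D>_interval U_sets by (intro emeasure_mono) auto
      finally have "ennreal (measure lebesgue (\<Union>\<D>)) < ennreal \<eta>"
        using U_small by (rule le_less_trans)
      then show ?thesis
        unfolding eq by (simp add: ennreal_less_iff)
    qed
    have "(\<Sum>(u, v)\<in>ends ` \<D>. \<bar>f v - f u\<bar>) < e"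
    proof (rule \<delta>)
      show "finite (ends ` \<D>)" using \<open>finite \<D>\<close> by simp
      show "\<forall>(u, v)\<in>ends ` \<D>. u \<le> v \<and> {u..v} \<subseteq> {a..b}"
        using \<D>_interval by (fastforce simp: ends_def)
      show "pairwise (\<lambda>p q. {fst p<..<snd p} \<inter> {fst q<..<snd q} = {}) (ends ` \<D>)"
      proof (rule pairwiseI)
        fix P Q assume "P \<in> ends ` \<D>" "Q \<in> ends ` \<D>" "P \<noteq> Q"
        then obtain k l where kl: "P = ends k" "Q = ends l" "k \<in> \<D>" "l \<in> \<D>" "k \<noteq> l" by auto
        have "interior k \<inter> interior l = {}" using division_ofD(5)[OF \<D> kl(3-5)] .
        then show "{fst P<..<snd P} \<inter> {fst Q<..<snd Q} = {}"
          using \<D>_interval[OF kl(3)] \<D>_interval[OF kl(4)] kl(1,2) by (auto simp: ends_def)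
      qed
      show "(\<Sum>(u, v)\<in>ends ` \<D>. v - u) < \<delta>"
        using \<D>_length unfolding sum.reindex[OF inj] by (simp add: ends_def o_def \<eta>_def)
    qed
    then have "(\<Sum>k\<in>\<D>. \<bar>f (Sup k) - f (Inf k)\<bar>) < e"
      unfolding sum.reindex[OF inj] by (simp add: ends_def o_def)
    \<comment> \<open>Passes from tagged pairs to bare intervals, once for the increments of
      \<open>f\<close> and once for the lengths.\<close>
    moreover have over_\<D>: "(\<Sum>(t, k)\<in>q. g (Inf k) (Sup k)) = (\<Sum>k\<in>\<D>. g (Inf k) (Sup k))"
      if "\<And>u. g u u = 0" for g :: "real \<Rightarrow> real \<Rightarrow> real"
    proof -
      \<comment> \<open>\<open>Inf {}\<close> and \<open>Sup {}\<close> are junk, but the division lemma also asks about empty boxes.\<close>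
      define h where "h k = (if k = {} then 0 else g (Inf k) (Sup k))" for k
      have "(\<Sum>(t, k)\<in>q. g (Inf k) (Sup k)) = (\<Sum>(t, k)\<in>q. h k)"
        using \<open>q \<subseteq> p\<close> pD(2) by (intro sum.cong) (force simp: h_def)+
      also have "\<dots> = sum h \<D>"
        unfolding \<D>_def
      proof (rule sum.over_tagged_division_lemma[OF tagged_partial_division_of_Union_self[OF q_partial]])
        fix u v :: real assume "box u v = {}"
        then show "h (cbox u v) = 0"
          by (cases "u = v") (use that in \<open>auto simp: h_def\<close>)
      qed
      also have "\<dots> = (\<Sum>k\<in>\<D>. g (Inf k) (Sup k))"
        using division_ofD(3)[OF \<D>] by (intro sum.cong) (auto simp: h_def)
      finally show ?thesis .
    qed
    ultimately have q_small: "(\<Sum>(t, k)\<in>q. \<bar>f (Sup k) - f (Inf k)\<bar>) < e"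
      using over_\<D>[of "\<lambda>u v. \<bar>f v - f u\<bar>"] by simp
    define \<sigma> where "\<sigma> = (\<Sum>(t, k)\<in>q. Sup k - Inf k)"
    have \<sigma>: "\<sigma> < \<eta>"
      using \<D>_length over_\<D>[of "\<lambda>u v. v - u"] by (simp add: \<sigma>_def)
    have "\<sigma> \<ge> 0"
      unfolding \<sigma>_def using \<open>q \<subseteq> p\<close> interval by (force intro!: sum_nonneg)
    \<comment> \<open>Going through \<open>\<bar>c\<bar>\<close> covers both signs of
      \<open>c - e\<close>.\<close>
    have "(c - e) * \<sigma> \<le> \<bar>c\<bar> * \<eta>"
      using \<sigma> \<open>\<sigma> \<ge> 0\<close> e by (intro order_trans[OF mult_right_mono[of "c - e" "\<bar>c\<bar>"] mult_left_mono]) auto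
    then have c_\<sigma>: "(c - e) * \<sigma> \<le> e" using \<eta>_c by linarith
    have split: "sum g p = sum g q + sum g (p - q)" for g :: "_ \<Rightarrow> real"
      using pD(1) \<open>q \<subseteq> p\<close> by (simp add: sum.subset_diff add.commute)
    have total: "(\<Sum>(t, k)\<in>p. f (Sup k) - f (Inf k)) = f b - f a"
      by (rule additive_tagged_division_1[OF ab p(1)])
    have length: "\<sigma> + (\<Sum>(t, k)\<in>p - q. Sup k - Inf k) = b - a"
      using additive_tagged_division_1[OF ab p(1), of "\<lambda>u. u"] by (simp add: split \<sigma>_def)
    have "- (\<Sum>(t, k)\<in>q. \<bar>f (Sup k) - f (Inf k)\<bar>) \<le> (\<Sum>(t, k)\<in>q. f (Sup k) - f (Inf k))"
      unfolding sum_negf[symmetric] by (intro sum_mono) auto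
    \<comment> \<open>Each of these intervals contains its tag, so the straddle estimates to the
      left and right of it add up to one for the whole interval.\<close>
    moreover have "(c - e) * (\<Sum>(t, k)\<in>p - q. Sup k - Inf k) \<le> (\<Sum>(t, k)\<in>p - q. f (Sup k) - f (Inf k))"
      unfolding sum_distrib_left
    proof (rule sum_mono, clarify)
      fix t k assume tk: "(t, k) \<in> p" "(t, k) \<notin> q"
      then have "t \<notin> N" by (simp add: q_def)
      obtain u v where uv: "u \<le> v" "k = {u..v}" "t \<in> {u..v}" "{u..v} \<subseteq> {a..b}" "{u..v} \<subseteq> \<gamma> t"
        using interval[OF tk(1)] by blast
      have t: "t \<in> {a..b}" using uv by blast
      have "{u..v} \<subseteq> ball t (d t)" using uv(5) t \<open>t \<notin> N\<close> by (simp add: \<gamma>_def)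
      moreover have "u \<in> {u..v}" "v \<in> {u..v}" using uv(1) by simp_all
      ultimately have "u \<in> ball t (d t)" "v \<in> ball t (d t)" by blast+
      then have "(c - e) * (t - u) \<le> f t - f u" "(c - e) * (v - t) \<le> f v - f t"
        using d[OF t \<open>t \<notin> N\<close>, of u] d[OF t \<open>t \<notin> N\<close>, of v] uv(3)
        by (auto simp: dist_real_def abs_minus_commute)
      then show "(c - e) * (Sup k - Inf k) \<le> f (Sup k) - f (Inf k)"
        using uv(1,2) by (simp add: algebra_simps)
    qed
    ultimately have "f b - f a \<ge> (c - e) * (b - a - \<sigma>) - e"
      using q_small total split[of "\<lambda>(t, k). f (Sup k) - f (Inf k)"] length[symmetric] by simp
    then show ?thesis using c_\<sigma> by (simp add: algebra_simps)
  qed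
  show ?thesis
  proof (rule ccontr)
    assume "\<not> ?thesis"
    then have gap: "c * (b - a) - (f b - f a) > 0" by simp
    \<comment> \<open>This makes the error in \<open>approx\<close> half of the supposed
      deficit.\<close>
    define e where "e = (c * (b - a) - (f b - f a)) / (2 * (b - a + 2))"
    have "e > 0" using gap ab by (simp add: e_def)
    have "e * (b - a + 2) = (c * (b - a) - (f b - f a)) / 2"
      using ab by (simp add: e_def field_simps)
    then show False using approx[OF \<open>e > 0\<close>] gap by simp
  qed
qed

lemma absolutely_continuous_on_subset:
  assumes "absolutely_continuous_on S f" "T \<subseteq> S"
  shows "absolutely_continuous_on T f"
  unfolding absolutely_continuous_on_def
proof (intro allI impI)
  fix e :: real assume "e > 0"
  then obtain d where "d > 0" and d: "\<And>I. finite I \<and> (\<forall>(a, b)\<in>I. a \<le> b \<and> {a..b} \<subseteq> S) \<and>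
        pairwise (\<lambda>p q. {fst p<..<snd p} \<inter> {fst q<..<snd q} = {}) I \<and>
        (\<Sum>(a, b)\<in>I. b - a) < d \<Longrightarrow> (\<Sum>(a, b)\<in>I. \<bar>f b - f a\<bar>) < e"
    using assms(1) unfolding absolutely_continuous_on_def by meson
  show "\<exists>d>0. \<forall>I. finite I \<and> (\<forall>(a, b)\<in>I. a \<le> b \<and> {a..b} \<subseteq> T) \<and>
        pairwise (\<lambda>p q. {fst p<..<snd p} \<inter> {fst q<..<snd q} = {}) I \<and>
        (\<Sum>(a, b)\<in>I. b - a) < d \<longrightarrow> (\<Sum>(a, b)\<in>I. \<bar>f b - f a\<bar>) < e"
    using \<open>d > 0\<close> \<open>T \<subseteq> S\<close> by (intro exI[of _ d] conjI allI impI d) (auto 0 4)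
qed

lemma absolutely_continuous_on_uminus:
  assumes "absolutely_continuous_on S f"
  shows "absolutely_continuous_on S (\<lambda>t. - f t)"
proof -
  have "\<bar>- f b - - f a\<bar> = \<bar>f b - f a\<bar>" for a b by linarith
  then show ?thesis using assms by (simp only: absolutely_continuous_on_def)
qed

lemma absolutely_continuous_on_imp_continuous_on:
  fixes f :: "real \<Rightarrow> real"
  assumes "absolutely_continuous_on {a..b} f"
  shows "continuous_on {a..b} f"
  unfolding continuous_on_iff
proof (intro ballI allI impI)
  fix t and e :: real assume t: "t \<in> {a..b}" and "e > 0"
  then obtain d where "d > 0" and d: "\<And>I. finite I \<Longrightarrow> (\<forall>(u, v)\<in>I. u \<le> v \<and> {u..v} \<subseteq> {a..b}) \<Longrightarrow>
        pairwise (\<lambda>p q. {fst p<..<snd p} \<inter> {fst q<..<snd q} = {}) I \<Longrightarrow>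
        (\<Sum>(u, v)\<in>I. v - u) < d \<Longrightarrow> (\<Sum>(u, v)\<in>I. \<bar>f v - f u\<bar>) < e"
    using assms unfolding absolutely_continuous_on_def by meson
  have "\<bar>f s - f t\<bar> < e" if s: "s \<in> {a..b}" "\<bar>s - t\<bar> < d" for s
    using d[of "{(s, t)}"] d[of "{(t, s)}"] s t
    by (cases "s \<le> t") (auto simp: abs_minus_commute)
  then show "\<exists>d>0. \<forall>s\<in>{a..b}. dist s t < d \<longrightarrow> dist (f s) (f t) < e"
    using \<open>d > 0\<close> by (auto simp: dist_real_def)
qed

section \<open>Scalar relaxation equations and first exit times\<close>

text \<open>After the last time \<open>m\<close> with \<open>x m \<ge> c\<close>, the solution lies
  below \<open>c\<close> and hence below its input, so its derivative is nonnegative almost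
  everywhere and it cannot have dropped below \<open>x m\<close>.\<close>

lemma relaxation_ge:
  fixes x :: "real \<Rightarrow> real"
  assumes ac: "absolutely_continuous_on {0..T} x"
    and deriv: "AE t in lebesgue. 0 < t \<and> t < T \<longrightarrow> (x has_real_derivative r t * (I t - x t)) (at t)"
    and r: "\<And>t. 0 < t \<Longrightarrow> r t \<ge> 0" and I: "\<And>t. 0 < t \<Longrightarrow> t < T \<Longrightarrow> I t \<ge> c"
    and "0 \<le> T" "x 0 \<ge> c"
  shows "x T \<ge> c"
proof (rule ccontr)
  assume "\<not> c \<le> x T"
  define A where "A = {0..T} \<inter> x -` {c..}"
  have "closed A"
    unfolding A_def using absolutely_continuous_on_imp_continuous_on[OF ac]
    by (intro continuous_closed_preimage) auto
  moreover have "0 \<in> A" "bdd_above A" using assms by (auto simp: A_def)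
  ultimately have m: "Sup A \<in> A" using closed_contains_Sup by blast
  define m where "m = Sup A"
  have m_props: "0 \<le> m" "m \<le> T" "x m \<ge> c" using m by (auto simp: m_def A_def)
  have below: "x t < c" if "m < t" "t \<le> T" for t
  proof (rule ccontr)
    assume "\<not> x t < c"
    then have "t \<in> A" using that m_props by (auto simp: A_def)
    then show False using cSup_upper[OF _ \<open>bdd_above A\<close>, of t] that by (simp add: m_def)
  qed
  have "0 * (T - m) \<le> x T - x m"
  proof (rule absolutely_continuous_on_increment_ge[OF m_props(2)])
    show "absolutely_continuous_on {m..T} x"
      using ac by (rule absolutely_continuous_on_subset) (use m_props in auto)
    show "AE t in lebesgue. m < t \<and> t < T \<longrightarrow> (\<exists>D\<ge>0. (x has_real_derivative D) (at t))"
      using deriv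
    proof (eventually_elim, intro impI)
      fix t assume *: "0 < t \<and> t < T \<longrightarrow> (x has_real_derivative r t * (I t - x t)) (at t)" "m < t \<and> t < T"
      have "r t * (I t - x t) \<ge> 0"
        using r[of t] I[of t] below[of t] * m_props by (intro mult_nonneg_nonneg) auto
      then show "\<exists>D\<ge>0. (x has_real_derivative D) (at t)"
        using * m_props by (intro exI[of _ "r t * (I t - x t)"]) auto
    qed
  qed
  then show False using m_props \<open>\<not> c \<le> x T\<close> by simp
qed

text \<open>Comparison with \<open>c = 0\<close> would give only \<open>x T \<ge> 0\<close>.
  Strictness comes from \<open>x' \<ge> - B x\<close>, which limits the loss over a short final
  window to half of the maximum there.\<close>

lemma relaxation_pos:
  fixes x :: "real \<Rightarrow> real"
  assumes ac: "absolutely_continuous_on {0..T} x"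
    and deriv: "AE t in lebesgue. 0 < t \<and> t < T \<longrightarrow> (x has_real_derivative r t * (I t - x t)) (at t)"
    and r: "\<And>t. 0 < t \<Longrightarrow> r t \<ge> 0" and r_bdd: "AE t in lebesgue. 0 < t \<longrightarrow> r t \<le> B"
    and I: "\<And>t. 0 < t \<Longrightarrow> t < T \<Longrightarrow> I t \<ge> 0"
    and "0 < T" and pos: "\<And>t. 0 \<le> t \<Longrightarrow> t < T \<Longrightarrow> x t > 0"
  shows "x T > 0"
proof -
  \<comment> \<open>\<open>T / 2\<close> keeps the window inside positive times; the other bound
    yields \<open>\<bar>B\<bar> * \<eta> \<le> 1 / 2\<close>.\<close>
  define \<eta> where "\<eta> = min (T / 2) (1 / (2 * (\<bar>B\<bar> + 1)))"
  have "\<eta> > 0" "\<eta> < T" using \<open>0 < T\<close> by (auto simp: \<eta>_def min_def add_nonneg_pos)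
  have "(\<bar>B\<bar> + 1) * \<eta> \<le> (\<bar>B\<bar> + 1) * (1 / (2 * (\<bar>B\<bar> + 1)))"
    by (intro mult_left_mono) (auto simp: \<eta>_def)
  also have "\<dots> = 1 / 2" using abs_ge_zero[of B] by (simp add: field_simps del: abs_ge_zero)
  finally have B\<eta>: "\<bar>B\<bar> * \<eta> \<le> 1 / 2" using \<open>\<eta> > 0\<close> by (simp add: distrib_right)
  have cont: "continuous_on {T - \<eta>..T} x"
    using absolutely_continuous_on_imp_continuous_on[OF ac]
    by (rule continuous_on_subset) (use \<open>\<eta> < T\<close> in auto)
  \<comment> \<open>Starting from a maximum point gives \<open>x t \<le> x m\<close> afterwards, so
    the rate of decrease is at most the constant \<open>\<bar>B\<bar> * x m\<close>.\<close>
  then obtain m where m: "m \<in> {T - \<eta>..T}" and max: "\<And>t. t \<in> {T - \<eta>..T} \<Longrightarrow> x t \<le> x m"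
    using continuous_attains_sup[of "{T - \<eta>..T}" x] \<open>\<eta> > 0\<close> by auto
  have "x m > 0"
    using pos[of "T - \<eta>"] max[of "T - \<eta>"] \<open>\<eta> > 0\<close> \<open>\<eta> < T\<close> by simp
  define M where "M = \<bar>B\<bar> * x m"
  have "- M * (T - m) \<le> x T - x m"
  proof (rule absolutely_continuous_on_increment_ge)
    show "m \<le> T" using m by simp
    show "absolutely_continuous_on {m..T} x"
      using ac by (rule absolutely_continuous_on_subset) (use m \<open>\<eta> < T\<close> in auto)
    show "AE t in lebesgue. m < t \<and> t < T \<longrightarrow> (\<exists>D\<ge>- M. (x has_real_derivative D) (at t))"
      using deriv r_bdd
    proof (eventually_elim, intro impI)
      fix t assume *: "0 < t \<and> t < T \<longrightarrow> (x has_real_derivative r t * (I t - x t)) (at t)"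
        "0 < t \<longrightarrow> r t \<le> B" "m < t \<and> t < T"
      have t: "0 < t" "t < T" using * m \<open>\<eta> < T\<close> by auto
      have "r t * x t \<le> \<bar>B\<bar> * x m"
        using * t m max[of t] pos[of t] by (intro mult_mono) auto
      moreover have "0 \<le> r t * I t" using r[of t] I[of t] t by simp
      ultimately have "r t * (I t - x t) \<ge> - M" by (simp add: M_def right_diff_distrib)
      then show "\<exists>D\<ge>- M. (x has_real_derivative D) (at t)"
        using * t by (intro exI[of _ "r t * (I t - x t)"]) auto
    qed
  qed
  moreover have "M * (T - m) \<le> x m / 2"
  proof -
    have "M * (T - m) \<le> M * \<eta>" using m \<open>x m > 0\<close> by (intro mult_left_mono) (auto simp: M_def)
    also have "\<dots> = x m * (\<bar>B\<bar> * \<eta>)" by (simp add: M_def)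
    also have "\<dots> \<le> x m * (1 / 2)" using B\<eta> \<open>x m > 0\<close> by (intro mult_left_mono) auto
    finally show ?thesis by simp
  qed
  ultimately show ?thesis using \<open>x m > 0\<close> by simp
qed

text \<open>The closed set where \<open>u \<le> 0\<close> would have a least element, positive since
  \<open>u 0 > 0\<close>, and \<open>step\<close> excludes it. With \<open>u\<close> a minimum of
  two gaps, this treats both components at once.\<close>

lemma positive_by_first_zero:
  fixes u :: "real \<Rightarrow> real"
  assumes cont: "continuous_on {0..} u" and u0: "u 0 > 0"
    and step: "\<And>T. T > 0 \<Longrightarrow> (\<And>t. 0 \<le> t \<Longrightarrow> t < T \<Longrightarrow> u t > 0) \<Longrightarrow> u T > 0"
    and "t \<ge> 0"
  shows "u t > 0"
proof (rule ccontr)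
  assume "\<not> u t > 0"
  define Z where "Z = {0..} \<inter> u -` {..0}"
  have "closed Z" unfolding Z_def using cont by (intro continuous_closed_preimage) auto
  moreover have "t \<in> Z" "bdd_below Z" using \<open>t \<ge> 0\<close> \<open>\<not> u t > 0\<close> by (auto simp: Z_def)
  ultimately have T: "Inf Z \<in> Z" using closed_contains_Inf by blast
  then have "Inf Z > 0" using u0 by (cases "Inf Z = 0") (auto simp: Z_def)
  moreover have "u s > 0" if "0 \<le> s" "s < Inf Z" for s
    using cInf_lower[OF _ \<open>bdd_below Z\<close>, of s] that by (force simp: Z_def)
  ultimately have "u (Inf Z) > 0" by (rule step)
  then show False using T by (simp add: Z_def)
qed

section \<open>Stieltjes averages\<close>

text \<open>The interval has mass \<open>1 - G a = 1\<close>, the atoms at both ends included, so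
  the integral is an average of \<open>g\<close>.\<close>

lemma set_integral_left_stieltjes_bounds:
  fixes g :: "real \<Rightarrow> real"
  assumes G: "mono G" "\<And>s. continuous (at_left s) G" "(G \<longlongrightarrow> 1) (at_right b)" "G a = 0" "a \<le> b"
    and g: "continuous_on {a..b} g"
  shows "(\<And>s. s \<in> {a..b} \<Longrightarrow> m \<le> g s) \<Longrightarrow> m \<le> (LINT s:{a..b}|left_stieltjes_measure G. g s)"
    and "(\<And>s. s \<in> {a..b} \<Longrightarrow> g s \<le> m) \<Longrightarrow> (LINT s:{a..b}|left_stieltjes_measure G. g s) \<le> m"
proof -
  let ?M = "left_stieltjes_measure G"
  have M: "sets ?M = sets borel" by (simp add: left_stieltjes_measure_def)
  have mass: "emeasure ?M {a..b} = 1"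
    using emeasure_left_stieltjes_measure_Icc[OF G(1,2,3,5)] G(4) by simp
  then have mass': "measure ?M {a..b} = 1" by (simp add: measure_def)
  have const: "set_integrable ?M {a..b} (\<lambda>_. c)" "(LINT s:{a..b}|?M. c) = c" for c :: real
  proof -
    show "set_integrable ?M {a..b} (\<lambda>_. c)"
      unfolding set_integrable_def
      by (rule integrableI_bounded_set_indicator[where B = "\<bar>c\<bar>"]) (auto simp: M mass)
    show "(LINT s:{a..b}|?M. c) = c"
      using mass mass' by (subst set_integral_const) (auto simp: M)
  qed
  \<comment> \<open>Integrability is essential: the integral of a non-integrable function is 0 by
    default, which would break the comparison with constants.\<close>
  have g_int: "set_integrable ?M {a..b} g"
  proof -
    have "compact (g ` {a..b})" using g by (intro compact_continuous_image) auto
    then obtain B where B: "\<And>s. s \<in> {a..b} \<Longrightarrow> norm (g s) \<le> B"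
      using compact_imp_bounded bounded_iff by (metis imageI)
    have "set_borel_measurable borel {a..b} g"
      using borel_measurable_continuous_on_indicator[OF _ g] by (simp add: set_borel_measurable_def)
    then have "set_borel_measurable ?M {a..b} g"
      by (simp add: set_borel_measurable_def measurable_cong_sets[OF M refl])
    then show ?thesis
      using B by (intro set_integrable_bound[OF const(1)[of B]]) force+
  qed
  show "m \<le> (LINT s:{a..b}|?M. g s)" if "\<And>s. s \<in> {a..b} \<Longrightarrow> m \<le> g s"
    using set_integral_mono[OF const(1) g_int, of m] that const(2) by simp
  show "(LINT s:{a..b}|?M. g s) \<le> m" if "\<And>s. s \<in> {a..b} \<Longrightarrow> g s \<le> m"
    using set_integral_mono[OF g_int const(1), of m] that const(2) by simp
qed

section \<open>Inequalities for the extended inverse\<close>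

text \<open>If \<open>x \<le> f y\<close>, the intermediate value theorem puts \<open>x\<close> in
  the range, so the infinite branch is excluded and monotonicity gives a contradiction. The branch
  below \<open>f 0\<close> has value 0, which \<open>0 \<le> y\<close> rules out.\<close>

lemma less_extended_inverse:
  assumes cont: "continuous_on {0..} f" and f: "strict_mono_on {0..} f"
    and "0 \<le> y" and less: "ereal y < extended_inverse f x"
  shows "f y < x"
proof (rule ccontr)
  assume "\<not> f y < x"
  have "f 0 \<le> x" using \<open>0 \<le> y\<close> less by (auto simp: extended_inverse_def split: if_splits)
  have "x \<in> f ` {0..}"
    using IVT'[of f 0 x y] \<open>f 0 \<le> x\<close> \<open>\<not> f y < x\<close> \<open>0 \<le> y\<close> continuous_on_subset[OF cont, of "{0..y}"]
    by force
  then obtain p where p: "x = f p" "0 \<le> p" by auto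
  then have "extended_inverse f x = ereal p"
    using \<open>f 0 \<le> x\<close> strict_mono_on_imp_inj_on[OF f] by (simp add: extended_inverse_def the_inv_into_f_f)
  then have "y < p" using less by simp
  then show False
    using strict_mono_onD[OF f, of y p] p \<open>0 \<le> y\<close> \<open>\<not> f y < x\<close> by simp
qed

text \<open>A finite upper bound excludes the infinite branch, so \<open>x = f p\<close> with
  \<open>p < y\<close>.\<close>

lemma extended_inverse_less:
  assumes f: "strict_mono_on {0..} f" and "f 0 \<le> x" and less: "extended_inverse f x < ereal y"
  shows "x < f y"
proof -
  obtain p where p: "x = f p" "0 \<le> p"
    using \<open>f 0 \<le> x\<close> less by (auto simp: extended_inverse_def split: if_splits)
  then have "extended_inverse f x = ereal p"
    using \<open>f 0 \<le> x\<close> strict_mono_on_imp_inj_on[OF f] by (simp add: extended_inverse_def the_inv_into_f_f)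
  then show ?thesis using less p strict_mono_onD[OF f, of p y] by simp
qed

section \<open>A single equation with given input\<close>

text \<open>Isolates one equation of the system, so that both equations are instances with the roles
  of the components exchanged.\<close>

locale delayed_response =
  fixes f h r :: "real \<Rightarrow> real" and R :: "real \<Rightarrow> real \<Rightarrow> real"
  assumes f_cont: "continuous_on {0..} f" and f_strict: "strict_mono_on {0..} f"
    and f_nonneg: "\<forall>x\<ge>0. f x \<ge> 0"
    and h_le: "\<forall>t\<ge>0. h t \<le> t"
    and R_left: "\<forall>t\<ge>0. \<forall>s. continuous (at_left s) (R t)"
    and R_mono: "\<forall>t\<ge>0. mono (R t)"
    and R_zero: "\<forall>t\<ge>0. \<forall>s\<le>h t. R t s = 0"
    and R_one: "\<forall>t\<ge>0. (R t \<longlongrightarrow> 1) (at_right t)"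
    and r_bdd: "\<exists>B. AE t in lebesgue_on {0..}. \<bar>r t\<bar> \<le> B"
    and r_nonneg: "\<forall>t\<ge>0. r t \<ge> 0"
begin

definition delayed_mean :: "(real \<Rightarrow> real) \<Rightarrow> real \<Rightarrow> real" where
  "delayed_mean y t = (LINT s:{h t..t}|left_stieltjes_measure (R t). f (y s))"

text \<open>Here \<open>y\<close> is the input and \<open>x\<close> the response. Continuity of
  \<open>y\<close> on the whole line includes the history, which the mean sees when
  \<open>h t < 0\<close>.\<close>

definition responds :: "(real \<Rightarrow> real) \<Rightarrow> (real \<Rightarrow> real) \<Rightarrow> bool" where
  "responds x y \<longleftrightarrow> (\<forall>b\<ge>0. absolutely_continuous_on {0..b} x) \<and> continuous_on UNIV y \<and>
     (AE t in lebesgue. 0 \<le> t \<longrightarrow> (x has_real_derivative r t * (delayed_mean y t - x t)) (at t))"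

text \<open>Nonnegativity of \<open>y\<close> and \<open>L\<close> keeps all arguments where
  \<open>f\<close> is continuous and monotone.\<close>

lemma
  assumes "0 \<le> t" and y_cont: "continuous_on UNIV y" and y_nonneg: "\<And>s. s \<le> t \<Longrightarrow> 0 \<le> y s"
  shows delayed_mean_ge: "0 \<le> L \<Longrightarrow> (\<And>s. s \<le> t \<Longrightarrow> L \<le> y s) \<Longrightarrow> f L \<le> delayed_mean y t"
    and delayed_mean_le: "0 \<le> L \<Longrightarrow> (\<And>s. s \<le> t \<Longrightarrow> y s \<le> L) \<Longrightarrow> delayed_mean y t \<le> f L"
proof -
  have f_mono: "f u \<le> f v" if "0 \<le> u" "u \<le> v" for u v
    using strict_mono_on_leD[OF f_strict, of u v] that by simp
  have cont: "continuous_on {h t..t} (\<lambda>s. f (y s))"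
    by (rule continuous_on_compose2[OF f_cont continuous_on_subset[OF y_cont]]) (use y_nonneg in auto)
  note bounds = set_integral_left_stieltjes_bounds[of "R t" t "h t" "\<lambda>s. f (y s)" "f L",
      OF _ _ _ _ _ cont]
  show "f L \<le> delayed_mean y t" if "0 \<le> L" "\<And>s. s \<le> t \<Longrightarrow> L \<le> y s"
    unfolding delayed_mean_def
    by (rule bounds(1)) (use \<open>0 \<le> t\<close> that f_mono R_mono R_left R_one R_zero h_le in auto)
  show "delayed_mean y t \<le> f L" if "0 \<le> L" "\<And>s. s \<le> t \<Longrightarrow> y s \<le> L"
    unfolding delayed_mean_def
    by (rule bounds(2)) (use \<open>0 \<le> t\<close> that f_mono y_nonneg R_mono R_left R_one R_zero h_le in auto)
qed

text \<open>The mean at \<open>t < T\<close> sees the input only up to \<open>t\<close>, so bounds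
  strictly before \<open>T\<close> suffice; this is the form that the first-exit argument
  supplies.\<close>

lemma response_ge:
  assumes "responds x y" "0 \<le> T" "0 \<le> L" and y: "\<And>s. s < T \<Longrightarrow> L \<le> y s"
    and "c \<le> f L" "c \<le> x 0"
  shows "c \<le> x T"
proof (rule relaxation_ge[where x = x and T = T and r = r and I = "delayed_mean y"])
  show "absolutely_continuous_on {0..T} x" using assms by (simp add: responds_def)
  show "AE t in lebesgue. 0 < t \<and> t < T \<longrightarrow>
      (x has_real_derivative r t * (delayed_mean y t - x t)) (at t)"
    using assms(1) unfolding responds_def by (auto elim: eventually_mono)
  show "c \<le> delayed_mean y t" if "0 < t" "t < T" for t
    using delayed_mean_ge[of t y L] assms(1,3,5) order_trans[OF \<open>0 \<le> L\<close> y] y that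
    by (auto simp: responds_def)
qed (use assms r_nonneg in auto)

text \<open>The function \<open>- x\<close> relaxes towards \<open>- delayed_mean y\<close> at the
  same rate, so the lower comparison applies to it.\<close>

lemma response_le:
  assumes "responds x y" "0 \<le> T" "0 \<le> L" and y: "\<And>s. s < T \<Longrightarrow> 0 \<le> y s" "\<And>s. s < T \<Longrightarrow> y s \<le> L"
    and "f L \<le> c" "x 0 \<le> c"
  shows "x T \<le> c"
proof -
  have "- c \<le> - x T"
  proof (rule relaxation_ge[where x = "\<lambda>t. - x t" and T = T and r = r and I = "\<lambda>t. - delayed_mean y t"])
    show "absolutely_continuous_on {0..T} (\<lambda>t. - x t)"
      using assms by (simp add: responds_def absolutely_continuous_on_uminus)
    have "AE t in lebesgue. 0 \<le> t \<longrightarrow> (x has_real_derivative r t * (delayed_mean y t - x t)) (at t)"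
      using assms(1) by (simp add: responds_def)
    then show "AE t in lebesgue. 0 < t \<and> t < T \<longrightarrow>
        ((\<lambda>t. - x t) has_real_derivative r t * (- delayed_mean y t - - x t)) (at t)"
    proof eventually_elim
      case (elim t)
      have eq: "- (r t * (delayed_mean y t - x t)) = r t * (- delayed_mean y t - - x t)"
        by (simp add: algebra_simps)
      show ?case using elim DERIV_minus[of x _ t UNIV] unfolding eq[symmetric] by auto
    qed
    show "- c \<le> - delayed_mean y t" if "0 < t" "t < T" for t
      using delayed_mean_le[of t y L] assms(1,3,6) y that by (force simp: responds_def)
  qed (use assms r_nonneg in auto)
  then show ?thesis by simp
qed

lemma response_pos:
  assumes "responds x y" "0 < T" and y: "\<And>s. s < T \<Longrightarrow> 0 \<le> y s"
    and x: "\<And>s. 0 \<le> s \<Longrightarrow> s < T \<Longrightarrow> 0 < x s"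
  shows "0 < x T"
proof -
  obtain B where B: "AE t in lebesgue_on {0..}. \<bar>r t\<bar> \<le> B" using r_bdd by blast
  show ?thesis
  proof (rule relaxation_pos[where x = x and T = T and r = r and I = "delayed_mean y" and B = B])
    show "absolutely_continuous_on {0..T} x" using assms by (simp add: responds_def)
    show "AE t in lebesgue. 0 < t \<and> t < T \<longrightarrow>
        (x has_real_derivative r t * (delayed_mean y t - x t)) (at t)"
      using assms(1) unfolding responds_def by (auto elim: eventually_mono)
    show "AE t in lebesgue. 0 < t \<longrightarrow> r t \<le> B"
      using B by (auto simp: AE_restrict_space_iff elim: eventually_mono)
    show "0 \<le> delayed_mean y t" if "0 < t" "t < T" for t
    proof -
      have "f 0 \<le> delayed_mean y t"
        using delayed_mean_ge[of t y 0] assms(1) y that by (force simp: responds_def)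
      then show ?thesis using f_nonneg by (meson order_refl order_trans)
    qed
  qed (use assms r_nonneg in auto)
qed

lemma responds_continuous:
  assumes "responds x y"
  shows "continuous_on {0..} x"
proof -
  have "continuous_on {0..<b} x" for b
  proof (cases "0 \<le> b")
    case True
    then show ?thesis
      using assms absolutely_continuous_on_imp_continuous_on[of 0 b x]
      by (auto simp: responds_def intro: continuous_on_subset)
  qed simp
  then show ?thesis
    unfolding continuous_on_eq_continuous_within
  proof safe
    fix t :: real assume *: "\<And>b. \<forall>t\<in>{0..<b}. continuous (at t within {0..<b}) x" and "0 \<le> t"
    \<comment> \<open>Continuity is local: near \<open>t\<close> the sets \<open>{0..<t + 1}\<close>
      and \<open>{0..}\<close> coincide.\<close>
    have nhd: "at t within {0..<t + 1} = at t within {0..}"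
      by (rule at_within_nhd[of _ "{..<t + 1}"]) auto
    have "continuous (at t within {0..<t + 1}) x" using *[of "t + 1"] \<open>0 \<le> t\<close> by simp
    then show "continuous (at t within {0..}) x" by (simp only: nhd)
  qed
qed

end

section \<open>The coupled system and its invariant rectangles\<close>

locale delayed_pair =
  E1: delayed_response f1 h1 r1 R1 + E2: delayed_response f2 h2 r2 R2
  for f1 h1 r1 R1 f2 h2 r2 R2 +
  fixes x y :: "real \<Rightarrow> real"
  assumes x_responds: "E1.responds x y" and y_responds: "E2.responds y x"
begin

text \<open>Positivity of each component needs nonnegativity of the other; the first zero of their
  minimum breaks this circle. It supplies the sign information that a solution does not carry by
  definition.\<close>

lemma pair_pos:
  assumes past: "\<And>t. t \<le> 0 \<Longrightarrow> 0 \<le> x t" "\<And>t. t \<le> 0 \<Longrightarrow> 0 \<le> y t"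
    and init: "0 < x 0" "0 < y 0" and "0 \<le> t"
  shows "0 < x t \<and> 0 < y t"
proof -
  have "0 < min (x t) (y t)"
  proof (rule positive_by_first_zero[OF _ _ _ \<open>0 \<le> t\<close>])
    show "continuous_on {0..} (\<lambda>t. min (x t) (y t))"
      by (intro continuous_intros E1.responds_continuous[OF x_responds] E2.responds_continuous[OF y_responds])
    fix T :: real assume T: "0 < T" "\<And>t. 0 \<le> t \<Longrightarrow> t < T \<Longrightarrow> 0 < min (x t) (y t)"
    have nonneg: "0 \<le> x s" "0 \<le> y s" if "s < T" for s
      using T(2)[of s] past[of s] that by (cases "0 \<le> s"; simp)+
    show "0 < min (x T) (y T)"
      using E1.response_pos[OF x_responds T(1)] E2.response_pos[OF y_responds T(1)] T(2) nonneg by simp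
  qed (use init in simp)
  then show ?thesis by simp
qed

lemma pair_gt:
  assumes kl: "0 \<le> k" "0 \<le> l" "k < f1 l" "l < f2 k"
    and past: "\<And>t. t \<le> 0 \<Longrightarrow> k < x t" "\<And>t. t \<le> 0 \<Longrightarrow> l < y t" and "0 \<le> t"
  shows "k < x t \<and> l < y t"
proof -
  have "0 < min (x t - k) (y t - l)"
  proof (rule positive_by_first_zero[OF _ _ _ \<open>0 \<le> t\<close>])
    show "continuous_on {0..} (\<lambda>t. min (x t - k) (y t - l))"
      by (intro continuous_intros E1.responds_continuous[OF x_responds] E2.responds_continuous[OF y_responds])
    fix T :: real assume T: "0 < T" "\<And>t. 0 \<le> t \<Longrightarrow> t < T \<Longrightarrow> 0 < min (x t - k) (y t - l)"
    have ge: "k \<le> x s" "l \<le> y s" if "s < T" for s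
      using T(2)[of s] past[of s] that by (cases "0 \<le> s"; simp)+
    \<comment> \<open>The threshold \<open>min (f1 l) (x 0)\<close> is admissible for the comparison
      and still strictly above \<open>k\<close>, so strictness survives at \<open>T\<close>.\<close>
    have "min (f1 l) (x 0) \<le> x T"
      by (rule E1.response_ge[OF x_responds _ kl(2) ge(2)]) (use T in auto)
    moreover have "min (f2 k) (y 0) \<le> y T"
      by (rule E2.response_ge[OF y_responds _ kl(1) ge(1)]) (use T in auto)
    ultimately show "0 < min (x T - k) (y T - l)"
      using kl past[of 0] by (auto simp: min_def split: if_splits)
  qed (use past[of 0] in simp)
  then show ?thesis by simp
qed

text \<open>Upper bounds do not keep the components in the domain of the responses, hence the
  separate sign assumptions.\<close>

lemma pair_lt:
  assumes kl: "0 \<le> k" "0 \<le> l" "f1 l < k" "f2 k < l"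
    and past: "\<And>t. t \<le> 0 \<Longrightarrow> x t < k" "\<And>t. t \<le> 0 \<Longrightarrow> y t < l"
    and nonneg: "\<And>t. 0 \<le> x t" "\<And>t. 0 \<le> y t" and "0 \<le> t"
  shows "x t < k \<and> y t < l"
proof -
  have "0 < min (k - x t) (l - y t)"
  proof (rule positive_by_first_zero[OF _ _ _ \<open>0 \<le> t\<close>])
    show "continuous_on {0..} (\<lambda>t. min (k - x t) (l - y t))"
      by (intro continuous_intros E1.responds_continuous[OF x_responds] E2.responds_continuous[OF y_responds])
    fix T :: real assume T: "0 < T" "\<And>t. 0 \<le> t \<Longrightarrow> t < T \<Longrightarrow> 0 < min (k - x t) (l - y t)"
    have le: "x s \<le> k" "y s \<le> l" if "s < T" for s
      using T(2)[of s] past[of s] that by (cases "0 \<le> s"; simp)+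
    have "x T \<le> max (f1 l) (x 0)"
      by (rule E1.response_le[OF x_responds _ kl(2) nonneg(2) le(2)]) (use T in auto)
    moreover have "y T \<le> max (f2 k) (y 0)"
      by (rule E2.response_le[OF y_responds _ kl(1) nonneg(1) le(1)]) (use T in auto)
    ultimately show "0 < min (k - x T) (l - y T)"
      using kl past[of 0] by (auto simp: max_def split: if_splits)
  qed (use past[of 0] in simp)
  then show ?thesis by simp
qed

end

lemma is_solution_imp_delayed_pair:
  assumes "delayed_response f1 h1 r1 R1" "delayed_response f2 h2 r2 R2"
    and sol: "is_solution f1 f2 h1 h2 R1 R2 r1 r2 \<phi> \<psi> x y"
    and hist: "continuous_on {..0} \<phi>" "continuous_on {..0} \<psi>"
  shows "delayed_pair f1 h1 r1 R1 f2 h2 r2 R2 x y"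
proof -
  interpret E1: delayed_response f1 h1 r1 R1 by fact
  interpret E2: delayed_response f2 h2 r2 R2 by fact
  have cont: "continuous_on UNIV u"
    if ac: "\<forall>b\<ge>0. absolutely_continuous_on {0..b} u" and past: "\<forall>t\<le>0. u t = w t"
      and w: "continuous_on {..0} w" for u w :: "real \<Rightarrow> real"
  proof -
    \<comment> \<open>History and solution are glued at 0 on a closed cover; the open half-lines
      then exhaust the line.\<close>
    have "continuous_on {..<b} u" for b
    proof -
      have "continuous_on {..0} u" by (rule continuous_on_eq[OF w]) (use past in auto)
      moreover have "continuous_on {0..max b 0} u"
        using ac by (intro absolutely_continuous_on_imp_continuous_on) simp
      ultimately have "continuous_on ({..0} \<union> {0..max b 0}) u"
        by (intro continuous_on_closed_Un) auto
      then show ?thesis by (rule continuous_on_subset) auto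
    qed
    then have "continuous_on (\<Union>b\<in>UNIV. {..<b}) u" by (intro continuous_on_open_UN) auto
    moreover have "(\<Union>b\<in>UNIV. {..<b}) = (UNIV :: real set)" by (auto intro: lt_ex gt_ex)
    ultimately show ?thesis by simp
  qed
  show ?thesis
  proof unfold_locales
    show "E1.responds x y"
      using sol cont[of y \<psi>] hist by (simp add: is_solution_def E1.responds_def E1.delayed_mean_def)
    show "E2.responds y x"
      using sol cont[of x \<phi>] hist by (simp add: is_solution_def E2.responds_def E2.delayed_mean_def)
  qed
qed

section \<open>Rectangles close to the equilibrium\<close>

text \<open>Continuity of \<open>f2\<close> fixes \<open>k\<close> near \<open>K\<close>; then
  \<open>f1 (f2 k) < k\<close>, and continuity of \<open>f1\<close> at \<open>f2 k\<close> leaves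
  room for \<open>l\<close> just above it.\<close>

lemma upper_rectangle:
  assumes f1: "continuous_on {0..} f1" "strict_mono_on {0..} f1"
    and f2: "continuous_on {0..} f2" "strict_mono_on {0..} f2" "\<forall>x\<ge>0. f2 x \<ge> 0"
    and "0 < K" and above: "\<forall>x. x > K \<longrightarrow> ereal (f2 x) < extended_inverse f1 x" and "0 < e"
  obtains k l where "K < k" "k < K + e" "f2 K < l" "l < f2 K + e" "f1 l < k" "f2 k < l"
proof -
  obtain d where "d > 0" and d: "\<And>b. b \<ge> 0 \<Longrightarrow> \<bar>b - K\<bar> < d \<Longrightarrow> \<bar>f2 b - f2 K\<bar> < e"
    using f2(1) \<open>0 < K\<close> \<open>0 < e\<close> unfolding continuous_on_iff dist_real_def
    by (metis atLeast_iff less_imp_le)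
  define k where "k = K + min d e / 2"
  have k: "K < k" "k < K + e" "\<bar>k - K\<bar> < d"
    using \<open>0 < d\<close> \<open>0 < e\<close> by (auto simp: k_def min_def)
  have "f2 k < f2 K + e" using d[of k] k \<open>0 < K\<close> by simp
  have "f2 K < f2 k" using strict_mono_onD[OF f2(2), of K k] k \<open>0 < K\<close> by simp
  have "0 \<le> f2 k" using f2(3) k \<open>0 < K\<close> by simp
  have "f1 (f2 k) < k"
    using less_extended_inverse[OF f1 \<open>0 \<le> f2 k\<close>] above k by simp
  then obtain d' where "d' > 0" and d': "\<And>b. b \<ge> 0 \<Longrightarrow> \<bar>b - f2 k\<bar> < d' \<Longrightarrow> \<bar>f1 b - f1 (f2 k)\<bar> < k - f1 (f2 k)"
    using f1(1) \<open>0 \<le> f2 k\<close> unfolding continuous_on_iff dist_real_def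
    by (metis atLeast_iff diff_gt_0_iff_gt)
  define l where "l = f2 k + min d' (f2 K + e - f2 k) / 2"
  have l: "f2 k < l" "l < f2 K + e" "\<bar>l - f2 k\<bar> < d'"
    using \<open>0 < d'\<close> \<open>f2 k < f2 K + e\<close> by (auto simp: l_def min_def field_simps)
  have "f1 l < k" using d'[of l] l \<open>0 \<le> f2 k\<close> by simp
  then show thesis using that[of k l] k l \<open>f2 K < f2 k\<close> by simp
qed

lemma lower_rectangle:
  assumes f1: "continuous_on {0..} f1" "strict_mono_on {0..} f1" "0 \<le> f1 0" "f1 0 < K"
    and f2: "continuous_on {0..} f2" "strict_mono_on {0..} f2" "\<forall>x>0. f2 x > 0"
    and below: "\<forall>x. f1 0 < x \<and> x < K \<longrightarrow> ereal (f2 x) > extended_inverse f1 x" and "0 < e"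
  obtains k l where "0 \<le> k" "K - e < k" "k < K" "0 \<le> l" "f2 K - e < l" "l < f2 K" "k < f1 l" "l < f2 k"
proof -
  have "0 < K" using f1(3,4) by simp
  obtain d where "d > 0" and d: "\<And>b. b \<ge> 0 \<Longrightarrow> \<bar>b - K\<bar> < d \<Longrightarrow> \<bar>f2 b - f2 K\<bar> < e"
    using f2(1) \<open>0 < K\<close> \<open>0 < e\<close> unfolding continuous_on_iff dist_real_def
    by (metis atLeast_iff less_imp_le)
  \<comment> \<open>The bound \<open>K - f1 0\<close> keeps \<open>k\<close> above
    \<open>f1 0\<close>, where \<open>below\<close> applies.\<close>
  define k where "k = K - min (min d e) (K - f1 0) / 2"
  have k: "f1 0 < k" "k < K" "K - e < k" "\<bar>k - K\<bar> < d"
    using \<open>0 < d\<close> \<open>0 < e\<close> f1(4) by (auto simp: k_def min_def field_simps)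
  have "0 < k" using k f1(3) by simp
  have "f2 K - e < f2 k" using d[of k] k \<open>0 < k\<close> by simp
  have "f2 k < f2 K" using strict_mono_onD[OF f2(2), of k K] k \<open>0 < k\<close> by simp
  have "0 < f2 k" using f2(3) \<open>0 < k\<close> by simp
  have "k < f1 (f2 k)"
    using extended_inverse_less[OF f1(2)] below k by simp
  then obtain d' where "d' > 0" and d': "\<And>b. b \<ge> 0 \<Longrightarrow> \<bar>b - f2 k\<bar> < d' \<Longrightarrow> \<bar>f1 b - f1 (f2 k)\<bar> < f1 (f2 k) - k"
    using f1(1) \<open>0 < f2 k\<close> unfolding continuous_on_iff dist_real_def
    by (metis atLeast_iff diff_gt_0_iff_gt less_imp_le)
  \<comment> \<open>The three bounds ensure \<open>k < f1 l\<close>, \<open>0 < l\<close> and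
    \<open>f2 K - e < l\<close>.\<close>
  define l where "l = f2 k - min (min d' (f2 k)) (f2 k - (f2 K - e)) / 2"
  have l: "0 < l" "l < f2 k" "f2 K - e < l" "\<bar>l - f2 k\<bar> < d'"
    using \<open>0 < d'\<close> \<open>f2 K - e < f2 k\<close> \<open>0 < f2 k\<close> by (auto simp: l_def min_def field_simps)
  have "k < f1 l" using d'[of l] l by simp
  then show thesis using that[of k l] k l \<open>f2 k < f2 K\<close> \<open>0 < k\<close> by simp
qed

section \<open>Passage to the limit at the equilibrium\<close>

theorem theorem3p13:
  fixes f1 f2 h1 h2 r1 r2 \<phi> \<psi> :: "real \<Rightarrow> real"
    and R1 R2 :: "real \<Rightarrow> real \<Rightarrow> real"
    and K :: real
  assumes f1_cont: "continuous_on {0..} f1" and f2_cont: "continuous_on {0..} f2"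
    and f1_strict: "strict_mono_on {0..} f1" and f2_strict: "strict_mono_on {0..} f2"
    and f1_nonneg: "\<forall>x\<ge>0. f1 x \<ge> 0" and f2_nonneg: "\<forall>x\<ge>0. f2 x \<ge> 0"
    and f1_pos: "\<forall>x>0. f1 x > 0" and f2_pos: "\<forall>x>0. f2 x > 0"
    and K_pos: "K > 0"
    and K_eq: "extended_inverse f1 K = ereal (f2 K)"
    and K_unique: "\<forall>x>0. extended_inverse f1 x = ereal (f2 x) \<longrightarrow> x = K"
    and below_K: "\<forall>x. f1 0 < x \<and> x < K \<longrightarrow> ereal (f2 x) > extended_inverse f1 x"
    and above_K: "\<forall>x. x > K \<longrightarrow> ereal (f2 x) < extended_inverse f1 x"
    and h1_meas: "h1 \<in> borel_measurable (lebesgue_on {0..})"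
    and h2_meas: "h2 \<in> borel_measurable (lebesgue_on {0..})"
    and h1_le: "\<forall>t\<ge>0. h1 t \<le> t" and h2_le: "\<forall>t\<ge>0. h2 t \<le> t"
    and h1_lim: "filterlim h1 at_top at_top" and h2_lim: "filterlim h2 at_top at_top"
    and R1_left: "\<forall>t\<ge>0. \<forall>s. continuous (at_left s) (R1 t)"
    and R2_left: "\<forall>t\<ge>0. \<forall>s. continuous (at_left s) (R2 t)"
    and R1_mono: "\<forall>t\<ge>0. mono (R1 t)" and R2_mono: "\<forall>t\<ge>0. mono (R2 t)"
    and R1_int: "\<forall>s. locally_integrable_nonneg (\<lambda>t. R1 t s)"
    and R2_int: "\<forall>s. locally_integrable_nonneg (\<lambda>t. R2 t s)"
    and R1_zero: "\<forall>t\<ge>0. \<forall>s\<le>h1 t. R1 t s = 0"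
    and R2_zero: "\<forall>t\<ge>0. \<forall>s\<le>h2 t. R2 t s = 0"
    and R1_one: "\<forall>t\<ge>0. (R1 t \<longlongrightarrow> 1) (at_right t)"
    and R2_one: "\<forall>t\<ge>0. (R2 t \<longlongrightarrow> 1) (at_right t)"
    and r1_meas: "r1 \<in> borel_measurable (lebesgue_on {0..})"
    and r2_meas: "r2 \<in> borel_measurable (lebesgue_on {0..})"
    and r1_bdd: "\<exists>B. AE t in lebesgue_on {0..}. \<bar>r1 t\<bar> \<le> B"
    and r2_bdd: "\<exists>B. AE t in lebesgue_on {0..}. \<bar>r2 t\<bar> \<le> B"
    and r1_nonneg: "\<forall>t\<ge>0. r1 t \<ge> 0" and r2_nonneg: "\<forall>t\<ge>0. r2 t \<ge> 0"
    and \<phi>_cont: "continuous_on {..0} \<phi>" and \<psi>_cont: "continuous_on {..0} \<psi>"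
    and \<phi>_bdd: "bounded (\<phi> ` {..0})" and \<psi>_bdd: "bounded (\<psi> ` {..0})"
    and \<phi>_nonneg: "\<forall>t<0. \<phi> t \<ge> 0" and \<psi>_nonneg: "\<forall>t<0. \<psi> t \<ge> 0"
    and \<phi>_pos: "\<phi> 0 > 0" and \<psi>_pos: "\<psi> 0 > 0"
  shows "((\<forall>t\<le>0. \<phi> t \<ge> K \<and> \<psi> t \<ge> f2 K) \<longrightarrow>
            (\<forall>x y. is_solution f1 f2 h1 h2 R1 R2 r1 r2 \<phi> \<psi> x y \<longrightarrow>
               (\<forall>t\<ge>0. x t \<ge> K \<and> y t \<ge> f2 K))) \<and>
         ((\<forall>t\<le>0. \<phi> t \<le> K \<and> \<psi> t \<le> f2 K) \<longrightarrow>
            (\<forall>x y. is_solution f1 f2 h1 h2 R1 R2 r1 r2 \<phi> \<psi> x y \<longrightarrow>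
               (\<forall>t\<ge>0. x t \<le> K \<and> y t \<le> f2 K)))"
proof -
  have E1: "delayed_response f1 h1 r1 R1"
    using f1_cont f1_strict f1_nonneg h1_le R1_left R1_mono R1_zero R1_one r1_bdd r1_nonneg
    by unfold_locales
  have E2: "delayed_response f2 h2 r2 R2"
    using f2_cont f2_strict f2_nonneg h2_le R2_left R2_mono R2_zero R2_one r2_bdd r2_nonneg
    by unfold_locales
  have "0 < f2 K" using f2_pos K_pos by simp
  \<comment> \<open>Otherwise the inverse at \<open>K\<close> would be 0, by convention or because
    \<open>K = f1 0\<close>, contradicting its value \<open>f2 K > 0\<close>.\<close>
  have "f1 0 < K"
  proof (rule ccontr)
    assume "\<not> f1 0 < K"
    moreover have "the_inv_into {0..} f1 (f1 0) = 0"
      using strict_mono_on_imp_inj_on[OF f1_strict] by (simp add: the_inv_into_f_f)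
    ultimately have "extended_inverse f1 K = 0"
      by (cases "K = f1 0") (auto simp: extended_inverse_def zero_ereal_def)
    then show False using K_eq \<open>0 < f2 K\<close> by simp
  qed
  have ge: "K \<le> x t \<and> f2 K \<le> y t"
    if init: "\<forall>t\<le>0. \<phi> t \<ge> K \<and> \<psi> t \<ge> f2 K" and sol: "is_solution f1 f2 h1 h2 R1 R2 r1 r2 \<phi> \<psi> x y"
      and "0 \<le> t" for x y t
  proof -
    interpret delayed_pair f1 h1 r1 R1 f2 h2 r2 R2 x y
      using is_solution_imp_delayed_pair[OF E1 E2 sol \<phi>_cont \<psi>_cont] .
    have past: "K \<le> x s" "f2 K \<le> y s" if "s \<le> 0" for s
      using init sol that by (auto simp: is_solution_def)
    \<comment> \<open>Weak bounds on the history become strict relative to \<open>k < K\<close> and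
      \<open>l < f2 K\<close>, so the open rectangle is invariant; then \<open>e\<close> tends to
      0.\<close>
    have "K - e < x t \<and> f2 K - e < y t" if "0 < e" for e
    proof -
      obtain k l where kl: "0 \<le> k" "K - e < k" "k < K" "0 \<le> l" "f2 K - e < l" "l < f2 K" "k < f1 l" "l < f2 k"
        using lower_rectangle[OF f1_cont f1_strict _ \<open>f1 0 < K\<close> f2_cont f2_strict f2_pos below_K \<open>0 < e\<close>]
          f1_nonneg by auto
      have "k < x t \<and> l < y t"
        by (rule pair_gt) (use kl past \<open>0 \<le> t\<close> in \<open>auto intro: less_le_trans\<close>)
      then show ?thesis using kl by simp
    qed
    then show ?thesis by (metis add.commute field_le_epsilon diff_less_eq less_imp_le)
  qed
  have le: "x t \<le> K \<and> y t \<le> f2 K"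
    if init: "\<forall>t\<le>0. \<phi> t \<le> K \<and> \<psi> t \<le> f2 K" and sol: "is_solution f1 f2 h1 h2 R1 R2 r1 r2 \<phi> \<psi> x y"
      and "0 \<le> t" for x y t
  proof -
    interpret delayed_pair f1 h1 r1 R1 f2 h2 r2 R2 x y
      using is_solution_imp_delayed_pair[OF E1 E2 sol \<phi>_cont \<psi>_cont] .
    have past: "x s \<le> K" "y s \<le> f2 K" "0 \<le> x s" "0 \<le> y s" if "s \<le> 0" for s
      using init sol that \<phi>_nonneg \<psi>_nonneg \<phi>_pos \<psi>_pos
      by (auto simp: is_solution_def order_le_less)
    have "0 < x 0" "0 < y 0" using sol \<phi>_pos \<psi>_pos by (auto simp: is_solution_def)
    \<comment> \<open>Needed before the upper comparison, since the means can be bounded by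
      monotonicity only for nonnegative arguments.\<close>
    then have nonneg: "0 \<le> x s" "0 \<le> y s" for s
      using pair_pos[of s] past by (cases "0 \<le> s"; force)+
    have "x t < K + e \<and> y t < f2 K + e" if "0 < e" for e
    proof -
      obtain k l where kl: "K < k" "k < K + e" "f2 K < l" "l < f2 K + e" "f1 l < k" "f2 k < l"
        using upper_rectangle[OF f1_cont f1_strict f2_cont f2_strict f2_nonneg K_pos above_K \<open>0 < e\<close>] .
      have "x t < k \<and> y t < l"
        by (rule pair_lt)
          (use kl past nonneg K_pos \<open>0 < f2 K\<close> \<open>0 \<le> t\<close> in \<open>auto intro: le_less_trans\<close>)
      then show ?thesis using kl by simp
    qed
    then show ?thesis by (metis field_le_epsilon less_imp_le)
  qed
  show ?thesis using ge le by blast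
qed

end
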